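(* A finite connected graph $G$ is a partial cube if and only if for every vertex $v$ of $G$ the poset $\mathcal{L}_G^v$ is an upper locally distributive lattice whose Hasse diagram (as an undirected graph) contains $G$ as an isometric subgraph.
   Context: A partial cube is a graph admitting an injective, graph-distance-preserving map into the vertex set of some hypercube. A subgraph of $G$ is convex if it contains every shortest path of $G$ between any two of its vertices. $\mathcal{L}_G^v$ denotes the set of convex subgraphs of $G$ containing $v$, ordered by inclusion. In a lattice, an element is meet-irreducible if it cannot be written as the meet of elements all different from itself (the maximum counts as meet-reducible, being the empty meet). A finite lattice is upper locally distributive (ULD) if every element has a unique inclusion-minimal representation as a meet of meet-irreducible elements. The Hasse diagram is the graph on the lattice elements with an edge between $x$ and $y$ whenever one covers the other. $H'$ is an isometric subgraph of $H$ if distances in $H'$ equal distances in $H$ (here, $G$ is isomorphic to such a subgraph). *)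

theory Defs
  imports "Graph_Theory.Graph_Theory" "HOL-Algebra.Lattice"
begin

text \<open>
  A finite simple undirected graph is a \<^term>\<open>pair_graph\<close>: a finite, loop-free, symmetric relation
  on a vertex set, in which an edge joining \<open>x\<close> and \<open>y\<close> is the pair of arcs \<open>(x, y)\<close>, \<open>(y, x)\<close>.
\<close>

subsection \<open>Distances, shortest paths, convex and isometric subgraphs\<close>

definition graph_dist :: "'a pair_pre_digraph \<Rightarrow> 'a \<Rightarrow> 'a \<Rightarrow> ereal" where
  "graph_dist G u v = wf_digraph.\<mu> (with_proj G) (\<lambda>_. 1) u v"

definition shortest_path :: "'a pair_pre_digraph \<Rightarrow> 'a \<Rightarrow> ('a \<times> 'a) awalk \<Rightarrow> 'a \<Rightarrow> bool" where
  "shortest_path G u p v \<longleftrightarrow>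
     pre_digraph.apath (with_proj G) u p v \<and> ereal (real (length p)) = graph_dist G u v"

definition undirected_subgraph :: "'a pair_pre_digraph \<Rightarrow> 'a pair_pre_digraph \<Rightarrow> bool" where
  "undirected_subgraph H G \<longleftrightarrow> pair_graph H \<and> subgraph (with_proj H) (with_proj G)"

text \<open>
  The condition on \<open>set p\<close> only mentions the arcs of \<open>p\<close> in the direction of traversal; the reverse
  arcs are in \<open>H\<close> because \<open>H\<close> is symmetric.
\<close>
definition convex_subgraph :: "'a pair_pre_digraph \<Rightarrow> 'a pair_pre_digraph \<Rightarrow> bool" where
  "convex_subgraph H G \<longleftrightarrow> undirected_subgraph H G \<and>
     (\<forall>u \<in> pverts H. \<forall>v \<in> pverts H. \<forall>p. shortest_path G u p v \<longrightarrow>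
        set (pawalk_verts u p) \<subseteq> pverts H \<and> set p \<subseteq> parcs H)"

definition isometric_subgraph :: "'a pair_pre_digraph \<Rightarrow> 'a pair_pre_digraph \<Rightarrow> bool" where
  "isometric_subgraph H G \<longleftrightarrow> undirected_subgraph H G \<and>
     (\<forall>u \<in> pverts H. \<forall>v \<in> pverts H. graph_dist H u v = graph_dist G u v)"

definition contains_isometrically :: "'a pair_pre_digraph \<Rightarrow> 'b pair_pre_digraph \<Rightarrow> bool" where
  "contains_isometrically H G \<longleftrightarrow>
     (\<exists>H'. isometric_subgraph H' H \<and> digraph_iso (with_proj G) (with_proj H'))"

subsection \<open>Partial cubes\<close>

text \<open>A vertex of the \<open>n\<close>-cube, a 0/1-vector of length \<open>n\<close>, is given by its support.\<close>
definition hypercube :: "nat \<Rightarrow> nat set pair_pre_digraph" where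
  "hypercube n = \<lparr> pverts = Pow {..<n},
     parcs = {(A, B). A \<subseteq> {..<n} \<and> B \<subseteq> {..<n} \<and> card ((A - B) \<union> (B - A)) = 1} \<rparr>"

definition partial_cube :: "'a pair_pre_digraph \<Rightarrow> bool" where
  "partial_cube G \<longleftrightarrow> (\<exists>n f. f ` pverts G \<subseteq> pverts (hypercube n) \<and> inj_on f (pverts G) \<and>
     (\<forall>u \<in> pverts G. \<forall>v \<in> pverts G.
        graph_dist (hypercube n) (f u) (f v) = graph_dist G u v))"

subsection \<open>Upper locally distributive lattices and Hasse diagrams\<close>

text \<open>
  The set \<open>A\<close> may be empty, in which case its meet is the maximum; hence the maximum is not
  meet-irreducible.
\<close>
definition meet_irreducible :: "('a, 'b) gorder_scheme \<Rightarrow> 'a \<Rightarrow> bool" where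
  "meet_irreducible L m \<longleftrightarrow> m \<in> carrier L \<and> (\<forall>A \<subseteq> carrier L. is_glb L m A \<longrightarrow> m \<in> A)"

definition mi_representation :: "('a, 'b) gorder_scheme \<Rightarrow> 'a \<Rightarrow> 'a set \<Rightarrow> bool" where
  "mi_representation L x M \<longleftrightarrow> M \<subseteq> {m. meet_irreducible L m} \<and> is_glb L x M"

definition upper_locally_distributive :: "('a, 'b) gorder_scheme \<Rightarrow> bool" where
  "upper_locally_distributive L \<longleftrightarrow> lattice L \<and> finite (carrier L) \<and>
     (\<forall>x \<in> carrier L. \<exists>!M. mi_representation L x M \<and> (\<forall>M' \<subset> M. \<not> mi_representation L x M'))"

definition covers :: "('a, 'b) gorder_scheme \<Rightarrow> 'a \<Rightarrow> 'a \<Rightarrow> bool" where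
  "covers L y x \<longleftrightarrow> x \<in> carrier L \<and> y \<in> carrier L \<and> x \<sqsubset>\<^bsub>L\<^esub> y \<and>
     \<not> (\<exists>z \<in> carrier L. x \<sqsubset>\<^bsub>L\<^esub> z \<and> z \<sqsubset>\<^bsub>L\<^esub> y)"

definition hasse_diagram :: "('a, 'b) gorder_scheme \<Rightarrow> 'a pair_pre_digraph" where
  "hasse_diagram L = \<lparr> pverts = carrier L, parcs = {(x, y). covers L x y \<or> covers L y x} \<rparr>"

subsection \<open>The poset of convex subgraphs containing a vertex\<close>

definition convex_poset :: "'a pair_pre_digraph \<Rightarrow> 'a \<Rightarrow> 'a pair_pre_digraph gorder" where
  "convex_poset G v = \<lparr> carrier = {H. convex_subgraph H G \<and> v \<in> pverts H}, eq = (=),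
     le = (\<lambda>H K. subgraph (with_proj H) (with_proj K)) \<rparr>"

end

theory Submission
  imports Defs
begin

text \<open>
  Fix an isometric embedding into a hypercube, translated so that the vertex \<open>v\<close> becomes the empty
  set. A convex set containing \<open>v\<close> is determined by its span, the union of its labels. The
  meet-irreducible convex sets are the sides containing \<open>v\<close> of the cuts given by the coordinates,
  and the unique minimal representation of a convex set consists of the sides whose cuts contain an
  edge leaving the set. A covering step adds exactly one coordinate to the span, so mapping \<open>u\<close> to
  the convex hull of \<open>v\<close> and \<open>u\<close>, whose span is the label of \<open>u\<close>, is isometric.

  Conversely, label an element of an upper locally distributive lattice by the meet-irreducible
  elements that are not above it. Uniqueness of minimal representations forces the label to grow by
  exactly one element in every covering step, and labels turn joins into unions. Hence the Hasse
  diagram itself embeds isometrically into a hypercube, and so do its isometric subgraphs.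
\<close>

section \<open>Distances and labellings by sets\<close>

text \<open>Relation powers replace walks, so that distances are handled by induction on a number
  instead of a list of arcs. The condition \<open>u \<in> pverts G\<close> matters at length 0,
  where the power relates everything to itself.\<close>

lemma awalk_of_length_iff_relpow:
  assumes "pair_wf_digraph G" "u \<in> pverts G"
  shows "(\<exists>p. pre_digraph.awalk (with_proj G) u p v \<and> length p = k) \<longleftrightarrow> (u, v) \<in> parcs G ^^ k"
  using assms(2)
proof (induction k arbitrary: u)
  case 0
  then show ?case by (auto simp: pre_digraph.awalk_def pre_digraph.cas.simps)
next
  case (Suc k)
  interpret pair_wf_digraph G by fact
  have "(\<exists>p. awalk u p v \<and> length p = Suc k) \<longleftrightarrow>
      (\<exists>w. (u, w) \<in> parcs G \<and> (\<exists>p. awalk w p v \<and> length p = k))"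
  proof
    assume "\<exists>p. awalk u p v \<and> length p = Suc k"
    then obtain e p where "awalk u (e # p) v" "length p = k"
      by (auto simp: length_Suc_conv)
    then show "\<exists>w. (u, w) \<in> parcs G \<and> (\<exists>p. awalk w p v \<and> length p = k)"
      by (intro exI[of _ "snd e"]) (auto simp: awalk_Cons_iff)
  next
    assume "\<exists>w. (u, w) \<in> parcs G \<and> (\<exists>p. awalk w p v \<and> length p = k)"
    then obtain w p where "(u, w) \<in> parcs G" "awalk w p v" "length p = k"
      by blast
    then show "\<exists>p. awalk u p v \<and> length p = Suc k"
      by (intro exI[of _ "(u, w) # p"]) (auto simp: awalk_Cons_iff)
  qed
  also have "\<dots> \<longleftrightarrow> (\<exists>w. (u, w) \<in> parcs G \<and> (w, v) \<in> parcs G ^^ k)"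
    using Suc.IH in_arcsD2 by blast
  also have "\<dots> \<longleftrightarrow> (u, v) \<in> parcs G ^^ Suc k"
    using relpow_Suc_I2 relpow_Suc_D2 by metis
  finally show ?case .
qed

lemma graph_dist_eq_INF_relpow:
  assumes "pair_wf_digraph G" "u \<in> pverts G"
  shows "graph_dist G u v = (INF k\<in>{k. (u, v) \<in> parcs G ^^ k}. ereal (real k))"
proof -
  interpret pair_wf_digraph G by fact
  have cost: "awalk_cost (\<lambda>_. 1) p = real (length p)" for p :: "('a \<times> 'a) list"
    by (induction p) auto
  have "(\<lambda>p. ereal (awalk_cost (\<lambda>_. 1) p)) ` {p. awalk u p v} =
      (\<lambda>k. ereal (real k)) ` {k. (u, v) \<in> parcs G ^^ k}"
    unfolding cost awalk_of_length_iff_relpow[OF assms, of v, symmetric] by (auto simp: image_def)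
  then show ?thesis
    by (simp add: graph_dist_def \<mu>_def)
qed

lemma graph_dist_eqI:
  assumes "pair_wf_digraph G" "u \<in> pverts G" "(u, v) \<in> parcs G ^^ n"
    and "\<And>k. (u, v) \<in> parcs G ^^ k \<Longrightarrow> n \<le> k"
  shows "graph_dist G u v = ereal (real n)"
  unfolding graph_dist_eq_INF_relpow[OF assms(1,2)]
  using assms(3,4) by (intro INF_eqI) auto

lemma card_sym_diff_triangle:
  assumes "finite A" "finite B" "finite C"
  shows "card (sym_diff A C) \<le> card (sym_diff A B) + card (sym_diff B C)"
proof -
  have "card (sym_diff A C) \<le> card (sym_diff A B \<union> sym_diff B C)"
    using assms by (intro card_mono) auto
  then show ?thesis
    using card_Un_le[of "sym_diff A B" "sym_diff B C"] by linarith
qed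

text \<open>Triangle inequality along the walk: labels that change by at most one element per step
  bound the length of every walk from below.\<close>

lemma card_sym_diff_le_relpow:
  assumes "\<And>a b. (a, b) \<in> E \<Longrightarrow> a \<in> V \<and> b \<in> V \<and> card (sym_diff (f a) (f b)) \<le> 1"
    and "\<And>a. a \<in> V \<Longrightarrow> finite (f a)" "u \<in> V" "(u, w) \<in> E ^^ k"
  shows "card (sym_diff (f u) (f w)) \<le> k"
  using assms(3,4)
proof (induction k arbitrary: u)
  case 0
  then show ?case by simp
next
  case (Suc k)
  then obtain a where a: "(u, a) \<in> E" "(a, w) \<in> E ^^ k"
    using relpow_Suc_D2 by metis
  then have "card (sym_diff (f a) (f w)) \<le> k"
    using Suc.IH assms(1) by blast
  \<comment> \<open>The triangle inequality needs \<open>f w\<close> to be finite; \<open>w\<close>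
    is either \<open>a\<close> or the end of the last step.\<close>
  moreover have "w \<in> V"
    using a assms(1) by (cases k) (auto elim: relpow_Suc_E)
  ultimately show ?case
    using card_sym_diff_triangle[of "f u" "f a" "f w"] a assms(1)[of u a] assms(2) by fastforce
qed

text \<open>An isometric map into a cube with coordinates of any type, since the size of the
  symmetric difference is the Hamming distance. The free coordinate type later admits
  meet-irreducible elements as coordinates.\<close>

definition cube_labelling :: "'a pair_pre_digraph \<Rightarrow> ('a \<Rightarrow> 'i set) \<Rightarrow> bool" where
  "cube_labelling G f \<longleftrightarrow> (\<forall>u \<in> pverts G. finite (f u)) \<and>
     (\<forall>u \<in> pverts G. \<forall>v \<in> pverts G. graph_dist G u v = ereal (real (card (sym_diff (f u) (f v)))))"

text \<open>The condition \<open>arc\<close> bounds distances from below, the condition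
  \<open>walk\<close> bounds them from above.\<close>

lemma cube_labellingI:
  assumes "pair_wf_digraph G"
    and finite: "\<And>u. u \<in> pverts G \<Longrightarrow> finite (f u)"
    and arc: "\<And>u v. (u, v) \<in> parcs G \<Longrightarrow> card (sym_diff (f u) (f v)) \<le> 1"
    and walk: "\<And>u v. u \<in> pverts G \<Longrightarrow> v \<in> pverts G \<Longrightarrow>
      (u, v) \<in> parcs G ^^ card (sym_diff (f u) (f v))"
  shows "cube_labelling G f"
proof -
  interpret pair_wf_digraph G by fact
  have "card (sym_diff (f u) (f v)) \<le> k" if "u \<in> pverts G" "(u, v) \<in> parcs G ^^ k" for u v k
    by (rule card_sym_diff_le_relpow[of "parcs G" "pverts G"]) (use assms wellformed' that in auto)
  then show ?thesis
    unfolding cube_labelling_def by (auto intro!: graph_dist_eqI assms)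
qed

section \<open>The cube, and the passage between labellings and embeddings into it\<close>

lemma pair_graph_hypercube: "pair_graph (hypercube n)"
proof -
  have "finite {(A, B). A \<subseteq> {..<n} \<and> B \<subseteq> {..<n} \<and> card (sym_diff A B) = 1}"
    by (rule finite_subset[of _ "Pow {..<n} \<times> Pow {..<n}"]) auto
  then show ?thesis
    unfolding hypercube_def
    by unfold_locales (auto simp: symmetric_def sym_def Un_commute)
qed

text \<open>Flipping the coordinates of the symmetric difference one at a time gives a walk of the
  required length.\<close>

lemma cube_labelling_hypercube: "cube_labelling (hypercube n) (\<lambda>A. A)"
proof (rule cube_labellingI)
  show "pair_wf_digraph (hypercube n)"
    using pair_graph_hypercube by (simp add: pair_graph_def pair_digraph_def pair_fin_digraph_def)
next
  fix A assume "A \<in> pverts (hypercube n)"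
  then show "finite A"
    by (auto simp: hypercube_def intro: finite_subset)
next
  fix A B assume "A \<in> pverts (hypercube n)" "B \<in> pverts (hypercube n)"
  moreover have "(A, B) \<in> parcs (hypercube n) ^^ k"
    if "A \<subseteq> {..<n}" "B \<subseteq> {..<n}" "card (sym_diff A B) = k" for k A
    using that
  proof (induction k arbitrary: A)
    case 0
    then have "finite A" "finite B"
      by (auto intro: finite_subset)
    with 0 show ?case by auto
  next
    case (Suc k)
    then obtain i where i: "i \<in> sym_diff A B"
      by (metis all_not_in_conv card.empty nat.distinct(1))
    define C where "C = sym_diff A {i}"
    have fin: "finite A" "finite B"
      using Suc.prems by (auto intro: finite_subset)
    have "sym_diff C B = sym_diff A B - {i}"
      using i by (auto simp: C_def)
    then have "card (sym_diff C B) = k"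
      using i Suc.prems(3) fin by simp
    moreover have sub: "C \<subseteq> {..<n}"
      using i Suc.prems by (auto simp: C_def)
    ultimately have "(C, B) \<in> parcs (hypercube n) ^^ k"
      using Suc.IH Suc.prems by blast
    moreover have "sym_diff A C = {i}"
      by (auto simp: C_def)
    then have "(A, C) \<in> parcs (hypercube n)"
      using Suc.prems sub by (simp add: hypercube_def)
    ultimately show ?case
      by (rule relpow_Suc_I2[rotated])
  qed
  ultimately show "(A, B) \<in> parcs (hypercube n) ^^ card (sym_diff A B)"
    by (simp add: hypercube_def)
qed (simp add: hypercube_def)

lemma cube_labelling_if_partial_cube:
  assumes "partial_cube G"
  obtains f :: "'a \<Rightarrow> nat set" where "cube_labelling (G :: 'a pair_pre_digraph) f"
proof -
  from assms obtain n f where f: "f ` pverts G \<subseteq> pverts (hypercube n)"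
    "\<forall>u \<in> pverts G. \<forall>v \<in> pverts G. graph_dist (hypercube n) (f u) (f v) = graph_dist G u v"
    unfolding partial_cube_def by blast
  have "cube_labelling G f"
    unfolding cube_labelling_def
  proof (intro conjI ballI)
    fix u v assume "u \<in> pverts G" "v \<in> pverts G"
    then show "finite (f u)" "graph_dist G u v = ereal (real (card (sym_diff (f u) (f v))))"
      using f cube_labelling_hypercube[of n] unfolding cube_labelling_def by (metis image_subset_iff)+
  qed
  then show thesis ..
qed

text \<open>Only finitely many coordinates occur in the labels, so they can be renumbered as an
  initial segment of the natural numbers.\<close>

lemma partial_cube_if_cube_labelling:
  assumes "pair_wf_digraph G" "finite (pverts G)" and f: "cube_labelling G f"
  shows "partial_cube G"
proof -
  interpret pair_wf_digraph G by fact
  define I where "I = \<Union> (f ` pverts G)"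
  have "finite I"
    using assms by (auto simp: I_def cube_labelling_def)
  then obtain h where h: "bij_betw h I {..<card I}"
    using ex_bij_betw_finite_nat atLeast0LessThan by metis
  define g where "g u = h ` f u" for u
  have fI: "f u \<subseteq> I" if "u \<in> pverts G" for u
    using that by (auto simp: I_def)
  then have gI: "g u \<subseteq> {..<card I}" if "u \<in> pverts G" for u
    using h that unfolding g_def bij_betw_def by blast
  have card_g: "card (sym_diff (g u) (g v)) = card (sym_diff (f u) (f v))"
    if "u \<in> pverts G" "v \<in> pverts G" for u v
  proof -
    have inj: "inj_on h (f u \<union> f v)"
      using h fI that by (meson bij_betw_def inj_on_subset le_sup_iff)
    then have "sym_diff (g u) (g v) = h ` sym_diff (f u) (f v)"
      unfolding g_def by (auto simp: inj_on_def)
    moreover have "inj_on h (sym_diff (f u) (f v))"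
      using inj by (rule inj_on_subset) auto
    ultimately show ?thesis
      by (simp only: card_image)
  qed
  have dist: "graph_dist (hypercube (card I)) (g u) (g v) = graph_dist G u v"
    if "u \<in> pverts G" "v \<in> pverts G" for u v
    using cube_labelling_hypercube[of "card I"] f gI that card_g
    unfolding cube_labelling_def by (simp add: hypercube_def)
  \<comment> \<open>Equal labels give distance 0, while every walk between distinct vertices has at
    least one arc.\<close>
  have "inj_on g (pverts G)"
  proof (rule inj_onI)
    fix u v assume uv: "u \<in> pverts G" "v \<in> pverts G" "g u = g v"
    then have "graph_dist G u v = 0"
      using f card_g[of u v] unfolding cube_labelling_def by simp
    show "u = v"
    proof (rule ccontr)
      assume "u \<noteq> v"
      then have "1 \<le> k" if "(u, v) \<in> parcs G ^^ k" for k
        using that by (cases k) auto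
      then have "1 \<le> graph_dist G u v"
        unfolding graph_dist_eq_INF_relpow[OF assms(1) uv(1)]
        by (intro INF_greatest) auto
      then show False
        using \<open>graph_dist G u v = 0\<close> by simp
    qed
  qed
  then show ?thesis
    unfolding partial_cube_def using gI dist
    by (intro exI[of _ "card I"] exI[of _ g]) (auto simp: hypercube_def)
qed

section \<open>Convex subgraphs of a connected graph\<close>

locale connected_pair_graph = pair_graph +
  assumes connected: "Digraph_Component.connected (with_proj G)"
begin

text \<open>The distance as a natural number. Between vertices of \<open>G\<close> the
  \<open>LEAST\<close> ranges over a nonempty set, by connectedness.\<close>

definition d :: "'a \<Rightarrow> 'a \<Rightarrow> nat" where
  "d u v = (LEAST k. (u, v) \<in> parcs G ^^ k)"

lemma relpow_d:
  assumes "u \<in> pverts G" "v \<in> pverts G"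
  shows "(u, v) \<in> parcs G ^^ d u v"
proof -
  have "strongly_connected (with_proj G)"
    using symmetric_connected_imp_strongly_connected sym_arcs connected by blast
  then obtain p where "awalk u p v"
    using assms by (auto simp: strongly_connected_def reachable_awalk)
  then have "\<exists>k. (u, v) \<in> parcs G ^^ k"
    using awalk_of_length_iff_relpow[OF pair_wf_digraph assms(1)] by blast
  then show ?thesis
    unfolding d_def by (rule LeastI_ex)
qed

lemma d_le:
  assumes "(u, v) \<in> parcs G ^^ k"
  shows "d u v \<le> k"
  unfolding d_def using assms by (rule Least_le)

lemma graph_dist_eq_d:
  assumes "u \<in> pverts G" "v \<in> pverts G"
  shows "graph_dist G u v = ereal (real (d u v))"
  using assms by (intro graph_dist_eqI relpow_d d_le) auto

lemma awalk_d:
  assumes "u \<in> pverts G" "v \<in> pverts G"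
  obtains p where "awalk u p v" "length p = d u v"
  using relpow_d[OF assms] awalk_of_length_iff_relpow[OF pair_wf_digraph assms(1)] by blast

lemma d_le_length:
  assumes "awalk u p v"
  shows "d u v \<le> length p"
  using assms awalk_of_length_iff_relpow[OF pair_wf_digraph, of u v "length p"]
  by (intro d_le) auto

lemma d_triangle:
  assumes "u \<in> pverts G" "v \<in> pverts G" "w \<in> pverts G"
  shows "d u v \<le> d u w + d w v"
  using assms by (intro d_le) (metis relpow_add relcomp.relcompI relpow_d)

lemma d_eq_0_iff:
  assumes "u \<in> pverts G" "v \<in> pverts G"
  shows "d u v = 0 \<longleftrightarrow> u = v"
  using relpow_d[OF assms] d_le[of u v 0] by auto

lemma d_arc:
  assumes "(u, v) \<in> parcs G"
  shows "d u v = 1"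
proof -
  have "d u v \<le> 1"
    using assms by (intro d_le) simp
  moreover have "d u v \<noteq> 0"
    using assms no_loops' d_eq_0_iff in_arcsD1 in_arcsD2 by metis
  ultimately show ?thesis by simp
qed

lemma ex_arc_on_geodesic:
  assumes "u \<in> pverts G" "v \<in> pverts G" "u \<noteq> v"
  obtains w where "(u, w) \<in> parcs G" "d u v = Suc (d w v)"
proof -
  obtain k where k: "d u v = Suc k"
    using assms d_eq_0_iff not0_implies_Suc by blast
  with relpow_d[OF assms(1,2)] obtain w where w: "(u, w) \<in> parcs G" "(w, v) \<in> parcs G ^^ k"
    using relpow_Suc_D2 by metis
  have "d w v \<le> k"
    using d_le[OF w(2)] .
  moreover have "d u v \<le> 1 + d w v"
    using d_triangle[of u v w] d_arc[OF w(1)] assms in_arcsD2[OF w(1)] by simp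
  ultimately show thesis
    using that w k by simp
qed

text \<open>A walk of minimal length cannot revisit a vertex, since cutting out the closed part
  would shorten it.\<close>

lemma shortest_path_iff:
  assumes "u \<in> pverts G" "v \<in> pverts G"
  shows "shortest_path G u p v \<longleftrightarrow> awalk u p v \<and> length p = d u v"
proof
  assume "shortest_path G u p v"
  then show "awalk u p v \<and> length p = d u v"
    using assms by (simp add: shortest_path_def graph_dist_eq_d apath_def)
next
  assume p: "awalk u p v \<and> length p = d u v"
  have "distinct (pawalk_verts u p)"
  proof (rule ccontr)
    assume "\<not> distinct (pawalk_verts u p)"
    then obtain q r s w where "p = q @ r @ s" "r \<noteq> []" "awalk u q w" "awalk w s v"
      using awalk_not_distinct_decomp[of u p v] p by auto
    then have "awalk u (q @ s) v" "length (q @ s) < length p"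
      by auto
    then show False
      using d_le_length[of u "q @ s" v] p by linarith
  qed
  then show "shortest_path G u p v"
    using assms p by (simp add: shortest_path_def graph_dist_eq_d apath_def)
qed

text \<open>Closure under metric intervals: the equation says that \<open>w\<close> lies on a
  shortest path from \<open>u\<close> to \<open>v\<close>.\<close>

definition geodesically_convex :: "'a set \<Rightarrow> bool" where
  "geodesically_convex X \<longleftrightarrow> X \<subseteq> pverts G \<and>
     (\<forall>u \<in> X. \<forall>v \<in> X. \<forall>w \<in> pverts G. d u w + d w v = d u v \<longrightarrow> w \<in> X)"

definition induced :: "'a set \<Rightarrow> 'a pair_pre_digraph" where
  "induced X = \<lparr>pverts = X, parcs = parcs G \<inter> X \<times> X\<rparr>"

lemma pverts_induced [simp]: "pverts (induced X) = X"
  by (simp add: induced_def)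

lemma induced_eq_iff [simp]: "induced X = induced Y \<longleftrightarrow> X = Y"
  by (metis pverts_induced)

lemma pair_graph_induced:
  assumes "X \<subseteq> pverts G"
  shows "pair_graph (induced X)"
proof -
  have "finite X"
    using assms pair_finite_verts finite_subset by blast
  then show ?thesis
    using pair_finite_arcs no_loops' arcs_symmetric
    by unfold_locales (auto simp: induced_def symmetric_def sym_def)
qed

lemma subgraph_induced_iff:
  assumes "X \<subseteq> pverts G" "Y \<subseteq> pverts G"
  shows "subgraph (with_proj (induced X)) (with_proj (induced Y)) \<longleftrightarrow> X \<subseteq> Y"
proof -
  have "wf_digraph (with_proj (induced Z))" if "Z \<subseteq> pverts G" for Z
    using pair_graph_induced[OF that]
    by (simp add: wf_digraph_wp_iff pair_graph_def pair_digraph_def pair_fin_digraph_def)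
  then show ?thesis
    using assms by (auto simp: subgraph_def induced_def)
qed

lemma subgraph_induced:
  assumes "X \<subseteq> pverts G"
  shows "subgraph (with_proj (induced X)) (with_proj G)"
proof -
  have "G = induced (pverts G)"
    using wellformed' by (intro pair_pre_digraph.equality) (auto simp: induced_def)
  then show ?thesis
    using subgraph_induced_iff[OF assms subset_refl] assms by simp
qed

text \<open>An arc is itself a shortest path, so a convex subgraph contains every arc of
  \<open>G\<close> between its vertices and is determined by its vertex set.\<close>

lemma convex_subgraph_iff:
  "convex_subgraph H G \<longleftrightarrow> geodesically_convex (pverts H) \<and> H = induced (pverts H)"
proof
  assume H: "convex_subgraph H G"
  then interpret H: pair_graph H
    by (simp add: convex_subgraph_def undirected_subgraph_def)
  from H have sub: "pverts H \<subseteq> pverts G" "parcs H \<subseteq> parcs G"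
    by (auto simp: convex_subgraph_def undirected_subgraph_def subgraph_def)
  have path: "set (pawalk_verts u p) \<subseteq> pverts H \<and> set p \<subseteq> parcs H"
    if "u \<in> pverts H" "v \<in> pverts H" "awalk u p v" "length p = d u v" for u v p
    using H that sub shortest_path_iff[of u v p] unfolding convex_subgraph_def by blast
  have "geodesically_convex (pverts H)"
    unfolding geodesically_convex_def
  proof (intro conjI ballI impI)
    fix u v w
    assume uv: "u \<in> pverts H" "v \<in> pverts H" and w: "w \<in> pverts G" "d u w + d w v = d u v"
    obtain p where p: "awalk u p w" "length p = d u w"
      using awalk_d sub uv w by blast
    obtain q where q: "awalk w q v" "length q = d w v"
      using awalk_d sub uv w by blast
    \<comment> \<open>The two geodesics joined at \<open>w\<close> form a walk of length
      \<open>d u v\<close>, hence a shortest path through \<open>w\<close>.\<close>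
    have "w \<in> set (pawalk_verts u (p @ q))"
      using set_awalk_verts_append[OF p(1) q(1)] p(1) awalk_verts_non_Nil[of u p]
      by (metis Un_iff awalkE' last_in_set)
    moreover have "awalk u (p @ q) v"
      using p q by (blast intro: awalk_appendI)
    ultimately show "w \<in> pverts H"
      using path[OF uv, of "p @ q"] p q w by auto
  qed (use sub in auto)
  moreover have "parcs H = parcs G \<inter> pverts H \<times> pverts H"
  proof (intro equalityI subrelI)
    fix a b assume ab: "(a, b) \<in> parcs G \<inter> pverts H \<times> pverts H"
    then have "awalk a [(a, b)] b"
      using wellformed' by (auto simp: awalk_simps)
    then show "(a, b) \<in> parcs H"
      using path[of a b "[(a, b)]"] ab d_arc by auto
  qed (use sub H.wellformed' in auto)
  ultimately show "geodesically_convex (pverts H) \<and> H = induced (pverts H)"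
    by (simp add: induced_def)
next
  assume "geodesically_convex (pverts H) \<and> H = induced (pverts H)"
  then obtain X where X: "geodesically_convex X" "H = induced X"
    by blast
  then have sub: "X \<subseteq> pverts G"
    by (simp add: geodesically_convex_def)
  show "convex_subgraph H G"
    unfolding convex_subgraph_def X(2) pverts_induced
  proof (intro conjI ballI allI impI)
    show "undirected_subgraph (induced X) G"
      unfolding undirected_subgraph_def using sub pair_graph_induced subgraph_induced by blast
  next
    fix u v p assume uv: "u \<in> X" "v \<in> X" "shortest_path G u p v"
    then have p: "awalk u p v" "length p = d u v"
      using shortest_path_iff sub by auto
    show verts: "set (pawalk_verts u p) \<subseteq> X"
    proof
      fix w assume "w \<in> set (pawalk_verts u p)"
      then obtain q r where qr: "p = q @ r" "awalk u q w" "awalk w r v"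
        using awalk_decomp p by blast
      then have w: "w \<in> pverts G"
        by blast
      have "d u w + d w v \<le> d u v"
        using d_le_length[OF qr(2)] d_le_length[OF qr(3)] qr(1) p(2) by simp
      then have "d u w + d w v = d u v"
        using d_triangle[of u v w] uv sub w by (simp add: le_antisym subset_iff)
      then show "w \<in> X"
        using X uv w unfolding geodesically_convex_def by blast
    qed
    show "set p \<subseteq> parcs (induced X)"
    proof
      fix e assume e: "e \<in> set p"
      have "fst e \<in> X" "snd e \<in> X"
        using awalk_verts_arc1[OF e, of u] awalk_verts_arc2[OF p(1) e] verts by blast+
      moreover have "e \<in> parcs G"
        using p(1) e by blast
      ultimately show "e \<in> parcs (induced X)"
        by (simp add: induced_def mem_Times_iff)
    qed
  qed
qed

section \<open>The lattice of convex vertex sets containing a given vertex\<close>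

lemma geodesically_convex_Inter:
  assumes "\<And>X. X \<in> \<C> \<Longrightarrow> geodesically_convex X"
  shows "geodesically_convex (pverts G \<inter> \<Inter> \<C>)"
  using assms unfolding geodesically_convex_def by blast

definition convex_sets :: "'a \<Rightarrow> 'a set set" where
  "convex_sets v = {X. geodesically_convex X \<and> v \<in> X}"

lemma convex_sets_subset_Pow: "convex_sets v \<subseteq> Pow (pverts G)"
  by (auto simp: convex_sets_def geodesically_convex_def)

lemma carrier_convex_poset: "carrier (convex_poset G v) = induced ` convex_sets v"
  by (auto simp: convex_poset_def convex_subgraph_iff convex_sets_def image_iff)

lemma le_convex_poset_iff:
  assumes "X \<in> convex_sets v" "Y \<in> convex_sets v"
  shows "induced X \<sqsubseteq>\<^bsub>convex_poset G v\<^esub> induced Y \<longleftrightarrow> X \<subseteq> Y"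
  using assms convex_sets_subset_Pow[of v] subgraph_induced_iff[of X Y]
  by (auto simp: convex_poset_def)

lemma eq_convex_poset [simp]: "eq (convex_poset G v) = (=)"
  by (simp add: convex_poset_def)

lemma Inter_in_convex_sets:
  assumes "v \<in> pverts G" "\<C> \<subseteq> convex_sets v"
  shows "pverts G \<inter> \<Inter> \<C> \<in> convex_sets v"
  using assms geodesically_convex_Inter[of \<C>] by (auto simp: convex_sets_def)

text \<open>Meets are intersections. The factor \<open>pverts G\<close> takes care of the empty
  family, whose meet is the maximum.\<close>

lemma is_glb_convex_poset_iff:
  assumes v: "v \<in> pverts G" and C: "\<C> \<subseteq> convex_sets v"
  shows "is_glb (convex_poset G v) m (induced ` \<C>) \<longleftrightarrow> m = induced (pverts G \<inter> \<Inter> \<C>)"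
    (is "is_glb ?L _ _ \<longleftrightarrow> _ = induced ?I")
proof -
  have I: "?I \<in> convex_sets v"
    using Inter_in_convex_sets[OF v C] .
  have lower: "induced Y \<in> Lower ?L (induced ` \<C>) \<longleftrightarrow> Y \<subseteq> ?I" if Y: "Y \<in> convex_sets v" for Y
  proof -
    have "induced Y \<sqsubseteq>\<^bsub>?L\<^esub> induced X \<longleftrightarrow> Y \<subseteq> X" if "X \<in> \<C>" for X
      using le_convex_poset_iff Y C that by blast
    moreover have "Y \<subseteq> pverts G"
      using Y convex_sets_subset_Pow by blast
    moreover have "induced ` \<C> \<subseteq> carrier ?L"
      using C by (auto simp: carrier_convex_poset)
    moreover have "induced Y \<in> carrier ?L"
      using Y by (simp add: carrier_convex_poset)
    ultimately show ?thesis
      unfolding Lower_def by blast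
  qed
  show ?thesis
  proof
    assume "is_glb ?L m (induced ` \<C>)"
    then have m: "m \<in> Lower ?L (induced ` \<C>)" "\<forall>y \<in> Lower ?L (induced ` \<C>). y \<sqsubseteq>\<^bsub>?L\<^esub> m"
      by (auto simp: greatest_def)
    then obtain M where M: "m = induced M" "M \<in> convex_sets v"
      by (metis (no_types, lifting) Lower_closed carrier_convex_poset imageE subsetD)
    then have "M \<subseteq> ?I" "induced ?I \<sqsubseteq>\<^bsub>?L\<^esub> induced M"
      using m lower I by auto
    then have "M = ?I"
      using M I le_convex_poset_iff by blast
    then show "m = induced ?I"
      using M by simp
  next
    assume m: "m = induced ?I"
    show "is_glb ?L m (induced ` \<C>)"
      unfolding greatest_def
    proof (intro conjI ballI)
      show "m \<in> Lower ?L (induced ` \<C>)"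
        using m lower[OF I] by blast
      fix y assume y: "y \<in> Lower ?L (induced ` \<C>)"
      then obtain Y where Y: "y = induced Y" "Y \<in> convex_sets v"
        by (metis (no_types, lifting) Lower_closed carrier_convex_poset imageE subsetD)
      then have "Y \<subseteq> ?I"
        using y lower by blast
      then show "y \<sqsubseteq>\<^bsub>?L\<^esub> m"
        unfolding m Y(1) le_convex_poset_iff[OF Y(2) I] .
    qed simp
  qed
qed

lemma lattice_convex_poset:
  assumes v: "v \<in> pverts G"
  shows "lattice (convex_poset G v)" (is "lattice ?L")
proof -
  have le: "x \<sqsubseteq>\<^bsub>?L\<^esub> y \<longleftrightarrow> pverts x \<subseteq> pverts y"
    if "x \<in> carrier ?L" "y \<in> carrier ?L" for x y
    using that unfolding carrier_convex_poset by (elim imageE) (simp only: le_convex_poset_iff pverts_induced)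
  interpret partial_order ?L
  proof unfold_locales
    fix x y assume *: "x \<sqsubseteq>\<^bsub>?L\<^esub> y" "y \<sqsubseteq>\<^bsub>?L\<^esub> x" "x \<in> carrier ?L" "y \<in> carrier ?L"
    then have "pverts x = pverts y"
      using le by blast
    then show "x .=\<^bsub>?L\<^esub> y"
      using *(3,4) unfolding carrier_convex_poset eq_convex_poset by (elim imageE) simp
  next
    fix x y z
    assume "x \<sqsubseteq>\<^bsub>?L\<^esub> y" "y \<sqsubseteq>\<^bsub>?L\<^esub> z" "x \<in> carrier ?L" "y \<in> carrier ?L" "z \<in> carrier ?L"
    then show "x \<sqsubseteq>\<^bsub>?L\<^esub> z"
      using le by blast
  qed (simp_all add: le)
  show ?thesis
  proof unfold_locales
    fix x y assume "x \<in> carrier ?L" "y \<in> carrier ?L"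
    then obtain X Y where XY: "x = induced X" "y = induced Y"
        "X \<in> convex_sets v" "Y \<in> convex_sets v"
      by (auto simp: carrier_convex_poset)
    then show "\<exists>s. is_glb ?L s {x, y}"
      using is_glb_convex_poset_iff[OF v, of "{X, Y}"] by simp
    \<comment> \<open>The join is the convex hull of \<open>X \<union> Y\<close>.\<close>
    define Z where "Z = pverts G \<inter> \<Inter> {Z \<in> convex_sets v. X \<union> Y \<subseteq> Z}"
    have Z: "Z \<in> convex_sets v"
      unfolding Z_def using v by (intro Inter_in_convex_sets) auto
    have upper: "induced W \<in> Upper ?L {x, y} \<longleftrightarrow> X \<union> Y \<subseteq> W" if "W \<in> convex_sets v" for W
      using that XY by (auto simp: Upper_def carrier_convex_poset le_convex_poset_iff)
    have "X \<union> Y \<subseteq> Z"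
      using XY convex_sets_subset_Pow by (auto simp: Z_def)
    then have "induced Z \<in> Upper ?L {x, y}"
      using upper Z by blast
    moreover have "induced Z \<sqsubseteq>\<^bsub>?L\<^esub> w" if w: "w \<in> Upper ?L {x, y}" for w
    proof -
      obtain W where W: "w = induced W" "W \<in> convex_sets v"
        using w by (metis (no_types, lifting) Upper_closed carrier_convex_poset imageE subsetD)
      then have "X \<union> Y \<subseteq> W"
        using upper w by blast
      then have "Z \<subseteq> W"
        using W(2) unfolding Z_def by blast
      then show ?thesis
        unfolding W(1) le_convex_poset_iff[OF Z W(2)] .
    qed
    ultimately have "is_lub ?L (induced Z) {x, y}"
      by (simp add: least_def)
    then show "\<exists>s. is_lub ?L s {x, y}" ..
  qed
qed

lemma finite_carrier_convex_poset: "finite (carrier (convex_poset G v))"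
  using finite_subset[OF convex_sets_subset_Pow] pair_finite_verts
  by (simp add: carrier_convex_poset)

lemma covers_convex_poset_iff:
  assumes "X \<in> convex_sets v" "Y \<in> convex_sets v"
  shows "covers (convex_poset G v) (induced Y) (induced X) \<longleftrightarrow>
    X \<subset> Y \<and> \<not> (\<exists>Z \<in> convex_sets v. X \<subset> Z \<and> Z \<subset> Y)"
proof -
  have less: "induced U \<sqsubset>\<^bsub>convex_poset G v\<^esub> induced W \<longleftrightarrow> U \<subset> W"
    if "U \<in> convex_sets v" "W \<in> convex_sets v" for U W
    unfolding lless_def le_convex_poset_iff[OF that] eq_convex_poset induced_eq_iff by blast
  have "(\<exists>z \<in> induced ` convex_sets v. induced X \<sqsubset>\<^bsub>convex_poset G v\<^esub> z \<and>
        z \<sqsubset>\<^bsub>convex_poset G v\<^esub> induced Y) \<longleftrightarrow>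
      (\<exists>Z \<in> convex_sets v. X \<subset> Z \<and> Z \<subset> Y)"
    unfolding bex_simps by (intro bex_cong refl) (simp only: less assms)
  then show ?thesis
    unfolding covers_def carrier_convex_poset less[OF assms] using assms by simp
qed

end

section \<open>Isometric copies inside another graph\<close>

definition image_graph :: "('a \<Rightarrow> 'b) \<Rightarrow> 'a pair_pre_digraph \<Rightarrow> 'b pair_pre_digraph" where
  "image_graph g G = \<lparr>pverts = g ` pverts G, parcs = map_prod g g ` parcs G\<rparr>"

text \<open>A general isomorphism also carries an arc map and new end point functions. Between pair
  graphs the latter must be the projections, so the vertex map determines the arc map.\<close>

lemma digraph_iso_with_proj_iff:
  assumes "pair_wf_digraph G"
  shows "digraph_iso (with_proj G) (with_proj H) \<longleftrightarrow>
    (\<exists>g. inj_on g (pverts G) \<and> H = image_graph g G)"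
proof
  interpret pair_wf_digraph G by fact
  assume "digraph_iso (with_proj G) (with_proj H)"
  then obtain h where h: "digraph_isomorphism h" "with_proj H = app_iso h (with_proj G)"
    by (auto simp: digraph_iso_def)
  define g where "g = iso_verts h"
  have "iso_tail h = fst" "iso_head h = snd" "pverts H = g ` pverts G" "parcs H = iso_arcs h ` parcs G"
    using h(2) by (simp_all add: with_proj_def app_iso_def g_def)
  moreover have "iso_arcs h e = map_prod g g e" if "e \<in> parcs G" for e
    using h(1) that calculation
    by (intro prod_eqI) (auto simp: digraph_isomorphism_def g_def)
  ultimately have "H = image_graph g G"
    by (simp add: image_graph_def)
  moreover have "inj_on g (pverts G)"
    using h(1) by (simp add: digraph_isomorphism_def g_def)
  ultimately show "\<exists>g. inj_on g (pverts G) \<and> H = image_graph g G"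
    by blast
next
  interpret pair_wf_digraph G by fact
  assume "\<exists>g. inj_on g (pverts G) \<and> H = image_graph g G"
  then obtain g where g: "inj_on g (pverts G)" "H = image_graph g G"
    by blast
  define h where "h = \<lparr>iso_verts = g, iso_arcs = map_prod g g, iso_head = snd, iso_tail = fst\<rparr>"
  have "inj_on (map_prod g g) (parcs G)"
    by (rule inj_on_subset[OF map_prod_inj_on[OF g(1) g(1)]]) (use wellformed' in auto)
  then have "digraph_isomorphism h"
    unfolding digraph_isomorphism_def h_def using g(1) wf_digraph_axioms by auto
  moreover have "with_proj H = app_iso h (with_proj G)"
    by (simp add: g(2) image_graph_def with_proj_def app_iso_def h_def)
  ultimately show "digraph_iso (with_proj G) (with_proj H)"
    unfolding digraph_iso_def by blast
qed

lemma relpow_map_prod: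
  assumes "(u, v) \<in> E ^^ k" "\<And>a b. (a, b) \<in> E \<Longrightarrow> (g a, g b) \<in> F"
  shows "(g u, g v) \<in> F ^^ k"
  using assms(1)
proof (induction k arbitrary: u)
  case (Suc k)
  then show ?case
    using assms(2) by (metis relpow_Suc_D2 relpow_Suc_I2)
qed simp

lemma relpow_symI:
  assumes "(u, v) \<in> E ^^ k" "\<And>a b. (a, b) \<in> E \<Longrightarrow> (b, a) \<in> E"
  shows "(v, u) \<in> E ^^ k"
  using assms(1)
proof (induction k arbitrary: u)
  case (Suc k)
  then show ?case
    using assms(2) by (metis relpow_Suc_D2 relpow_Suc_I)
qed simp

lemma graph_dist_image_graph:
  assumes "pair_wf_digraph G" "inj_on g (pverts G)" "u \<in> pverts G" "v \<in> pverts G"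
  shows "graph_dist (image_graph g G) (g u) (g v) = graph_dist G u v"
proof -
  interpret pair_wf_digraph G by fact
  have wf: "pair_wf_digraph (image_graph g G)"
    using wellformed' by unfold_locales (auto simp: image_graph_def)
  \<comment> \<open>The inverse of \<open>g\<close> on vertices carries walks of the image back to
    \<open>G\<close>.\<close>
  define h where "h = the_inv_into (pverts G) g"
  have h: "h (g w) = w" if "w \<in> pverts G" for w
    using that assms(2) by (simp add: h_def the_inv_into_f_f)
  have "(g u, g v) \<in> parcs (image_graph g G) ^^ k \<longleftrightarrow> (u, v) \<in> parcs G ^^ k" for k
  proof
    assume "(g u, g v) \<in> parcs (image_graph g G) ^^ k"
    then have "(h (g u), h (g v)) \<in> parcs G ^^ k"
      by (rule relpow_map_prod) (auto simp: image_graph_def h wellformed')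
    then show "(u, v) \<in> parcs G ^^ k"
      by (simp add: h assms)
  next
    assume "(u, v) \<in> parcs G ^^ k"
    then show "(g u, g v) \<in> parcs (image_graph g G) ^^ k"
      by (rule relpow_map_prod) (auto simp: image_graph_def)
  qed
  then show ?thesis
    using wf assms by (simp add: graph_dist_eq_INF_relpow image_graph_def)
qed

text \<open>The copy is \<open>image_graph g G\<close>: its distances agree with those of
  \<open>H\<close> because both agree with those of \<open>G\<close>.\<close>

lemma contains_isometricallyI:
  assumes "pair_graph G" "pair_wf_digraph H" "inj_on g (pverts G)" "g ` pverts G \<subseteq> pverts H"
    and arcs: "\<And>u v. (u, v) \<in> parcs G \<Longrightarrow> (g u, g v) \<in> parcs H"
    and dist: "\<And>u v. u \<in> pverts G \<Longrightarrow> v \<in> pverts G \<Longrightarrow>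
      graph_dist H (g u) (g v) = graph_dist G u v"
  shows "contains_isometrically H G"
proof -
  interpret pair_graph G by fact
  have image: "pair_graph (image_graph g G)"
    using pair_finite_verts pair_finite_arcs wellformed' no_loops' arcs_symmetric assms(3)
    by unfold_locales (auto simp: image_graph_def symmetric_def sym_def inj_on_def; blast)+
  then have "subgraph (with_proj (image_graph g G)) (with_proj H)"
    using assms
    by (auto simp: subgraph_def wf_digraph_wp_iff image_graph_def pair_graph_def pair_digraph_def
        pair_fin_digraph_def)
  moreover have "graph_dist (image_graph g G) x y = graph_dist H x y"
    if xy: "x \<in> pverts (image_graph g G)" "y \<in> pverts (image_graph g G)" for x y
  proof -
    obtain u v where "u \<in> pverts G" "v \<in> pverts G" "x = g u" "y = g v"
      using xy by (auto simp: image_graph_def)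
    then show ?thesis
      using dist graph_dist_image_graph[OF pair_wf_digraph assms(3)] by simp
  qed
  ultimately have "isometric_subgraph (image_graph g G) H"
    using image by (simp add: isometric_subgraph_def undirected_subgraph_def)
  moreover have "digraph_iso (with_proj G) (with_proj (image_graph g G))"
    using digraph_iso_with_proj_iff[OF pair_wf_digraph] assms(3) by blast
  ultimately show ?thesis
    unfolding contains_isometrically_def by blast
qed

lemma contains_isometricallyE:
  assumes "contains_isometrically H G" "pair_wf_digraph G"
  obtains g where "g ` pverts G \<subseteq> pverts H"
    "\<And>u v. u \<in> pverts G \<Longrightarrow> v \<in> pverts G \<Longrightarrow> graph_dist H (g u) (g v) = graph_dist G u v"
proof -
  obtain H' g where H': "isometric_subgraph H' H" "inj_on g (pverts G)" "H' = image_graph g G"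
    using assms unfolding contains_isometrically_def digraph_iso_with_proj_iff[OF assms(2)] by blast
  then have verts: "g ` pverts G = pverts H'"
    by (simp add: image_graph_def)
  show thesis
  proof (rule that[of g])
    show "g ` pverts G \<subseteq> pverts H"
      using H'(1) unfolding verts
      by (simp add: isometric_subgraph_def undirected_subgraph_def subgraph_def)
  next
    fix u v assume "u \<in> pverts G" "v \<in> pverts G"
    moreover from this have "g u \<in> pverts H'" "g v \<in> pverts H'"
      unfolding verts[symmetric] by auto
    then have "graph_dist H (g u) (g v) = graph_dist H' (g u) (g v)"
      using H'(1) unfolding isometric_subgraph_def by simp
    ultimately show "graph_dist H (g u) (g v) = graph_dist G u v"
      using graph_dist_image_graph[OF assms(2) H'(2)] H'(3) by simp
  qed
qed

section \<open>Upper locally distributive lattices\<close>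

lemma pair_wf_digraph_hasse_diagram: "pair_wf_digraph (hasse_diagram L)"
  by unfold_locales (auto simp: hasse_diagram_def covers_def)

lemma mi_representation_iff:
  "mi_representation L x M \<longleftrightarrow> M \<subseteq> {m. meet_irreducible L m} \<and> x \<in> carrier L \<and>
     (\<forall>m \<in> M. x \<sqsubseteq>\<^bsub>L\<^esub> m) \<and> (\<forall>z \<in> carrier L. (\<forall>m \<in> M. z \<sqsubseteq>\<^bsub>L\<^esub> m) \<longrightarrow> z \<sqsubseteq>\<^bsub>L\<^esub> x)"
proof (cases "M \<subseteq> {m. meet_irreducible L m}")
  case True
  \<comment> \<open>\<open>Lower\<close> restricts its argument to the carrier, which has no effect
    on sets of meet-irreducible elements.\<close>
  then have "M \<inter> carrier L = M"
    by (auto simp: meet_irreducible_def)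
  with True show ?thesis
    unfolding mi_representation_def greatest_def Lower_def by auto
qed (simp add: mi_representation_def)

locale uld_lattice = lattice +
  assumes uld: "upper_locally_distributive L"
begin

lemma finite_carrier: "finite (carrier L)"
  using uld by (simp add: upper_locally_distributive_def)

text \<open>By finiteness every representation contains a minimal one. As the minimal one is unique,
  it lies in all representations.\<close>

lemma least_mi_representation:
  assumes "x \<in> carrier L"
  obtains M where "mi_representation L x M" "\<And>M'. mi_representation L x M' \<Longrightarrow> M \<subseteq> M'"
proof -
  have ex1: "\<exists>!M. mi_representation L x M \<and> (\<forall>M' \<subset> M. \<not> mi_representation L x M')"
    using assms uld by (simp add: upper_locally_distributive_def)
  then obtain M where M: "mi_representation L x M" "\<forall>M' \<subset> M. \<not> mi_representation L x M'"
    by blast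
  have "M \<subseteq> M'" if M': "mi_representation L x M'" for M'
  proof -
    have "M' \<subseteq> carrier L"
      using M' by (auto simp: mi_representation_def meet_irreducible_def)
    then have "finite M'"
      using finite_carrier by (rule finite_subset)
    then have "finite {N. N \<subseteq> M' \<and> mi_representation L x N}"
      by simp
    then obtain N where N: "N \<in> {N. N \<subseteq> M' \<and> mi_representation L x N}"
      "\<forall>K \<in> {N. N \<subseteq> M' \<and> mi_representation L x N}. K \<subseteq> N \<longrightarrow> N = K"
      using finite_has_minimal2[of "{N. N \<subseteq> M' \<and> mi_representation L x N}" M'] M' by blast
    then have "\<forall>K \<subset> N. \<not> mi_representation L x K"
      by blast
    then show "M \<subseteq> M'"
      using ex1 M N by blast
  qed
  with M(1) show thesis
    using that by blast
qed

text \<open>Taking the irreducibles that are not above \<open>x\<close> makes the labels grow with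
  \<open>x\<close>.\<close>

definition label :: "'a \<Rightarrow> 'a set" where
  "label x = {m. meet_irreducible L m \<and> \<not> x \<sqsubseteq> m}"

lemma finite_label: "finite (label x)"
  using finite_carrier by (rule finite_subset[rotated]) (auto simp: label_def meet_irreducible_def)

text \<open>Every element is a meet of meet-irreducible elements, so the labels determine the
  order.\<close>

lemma label_subset_iff:
  assumes "x \<in> carrier L" "y \<in> carrier L"
  shows "label x \<subseteq> label y \<longleftrightarrow> x \<sqsubseteq> y"
proof
  assume sub: "label x \<subseteq> label y"
  obtain M where M: "mi_representation L y M"
    using least_mi_representation assms by blast
  then have "x \<sqsubseteq> m" if "m \<in> M" for m
    using sub that unfolding mi_representation_iff label_def by blast
  then show "x \<sqsubseteq> y"
    using M assms unfolding mi_representation_iff by blast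
next
  assume "x \<sqsubseteq> y"
  then show "label x \<subseteq> label y"
    using assms le_trans unfolding label_def meet_irreducible_def by blast
qed

lemma label_join:
  assumes "x \<in> carrier L" "y \<in> carrier L"
  shows "label (x \<squnion> y) = label x \<union> label y"
proof -
  have "x \<squnion> y \<sqsubseteq> m \<longleftrightarrow> x \<sqsubseteq> m \<and> y \<sqsubseteq> m" if "m \<in> carrier L" for m
    using that assms join_le join_left join_right le_trans join_closed by meson
  then show ?thesis
    unfolding label_def meet_irreducible_def by blast
qed

text \<open>Let \<open>U\<close> consist of the irreducibles above \<open>y\<close>. Each new
  element \<open>m\<close> of the label gives a representation \<open>insert m U\<close> of
  \<open>x\<close>. With two new elements, the least representation would lie in both of these,
  hence in \<open>U\<close>, and its meet \<open>x\<close> would be above \<open>y\<close>.\<close>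

lemma label_cover:
  assumes "covers L y x"
  obtains m where "m \<notin> label x" "label y = insert m (label x)"
proof -
  have xy: "x \<in> carrier L" "y \<in> carrier L" "x \<sqsubseteq> y" "x \<noteq> y"
    using assms unfolding covers_def lless_def eq_is_equal by auto
  have between: "z = x \<or> z = y" if "z \<in> carrier L" "x \<sqsubseteq> z" "z \<sqsubseteq> y" for z
    using assms that unfolding covers_def lless_def eq_is_equal by auto
  have sub: "label x \<subseteq> label y"
    using label_subset_iff xy by blast
  have not_le: "\<not> y \<sqsubseteq> x"
    using xy le_antisym by blast
  define U where "U = {m. meet_irreducible L m \<and> y \<sqsubseteq> m}"
  have rep: "mi_representation L x (insert m U)" if m: "m \<in> label y - label x" for m
  proof -
    have m: "meet_irreducible L m" "m \<in> carrier L" "x \<sqsubseteq> m" "\<not> y \<sqsubseteq> m"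
      using m by (auto simp: label_def meet_irreducible_def)
    \<comment> \<open>This meet lies between \<open>x\<close> and \<open>y\<close> and differs from
      \<open>y\<close>, so the covering relation forces it to be \<open>x\<close>.\<close>
    have "y \<sqinter> m = x"
      using between[of "y \<sqinter> m"] m xy meet_closed meet_left meet_right meet_le by metis
    have "z \<sqsubseteq> x" if z: "z \<in> carrier L" "\<forall>n \<in> insert m U. z \<sqsubseteq> n" for z
    proof -
      \<comment> \<open>Being below all irreducibles above \<open>y\<close> puts \<open>z\<close>
        below \<open>y\<close> itself.\<close>
      have "label z \<subseteq> label y"
        using z unfolding label_def U_def by blast
      then have "z \<sqsubseteq> y"
        using label_subset_iff z xy by blast
      then have "z \<sqsubseteq> y \<sqinter> m"
        using z m xy by (intro meet_le) auto
      then show ?thesis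
        using \<open>y \<sqinter> m = x\<close> by simp
    qed
    moreover have "x \<sqsubseteq> n" if "n \<in> U" for n
      using that xy le_trans unfolding U_def meet_irreducible_def by blast
    ultimately show ?thesis
      using m xy unfolding mi_representation_iff U_def by blast
  qed
  have eq: "m = n" if mn: "m \<in> label y - label x" "n \<in> label y - label x" for m n
  proof (rule ccontr)
    assume "m \<noteq> n"
    obtain M where M: "mi_representation L x M" "\<And>M'. mi_representation L x M' \<Longrightarrow> M \<subseteq> M'"
      using least_mi_representation xy by blast
    then have "M \<subseteq> U"
      using rep[OF mn(1)] rep[OF mn(2)] \<open>m \<noteq> n\<close> by blast
    then have "y \<sqsubseteq> x"
      using M(1) xy unfolding mi_representation_iff U_def by blast
    then show False
      using not_le by blast
  qed
  obtain m where m: "m \<in> label y - label x"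
    using not_le label_subset_iff xy by blast
  then have "label y = insert m (label x)"
    using sub eq by blast
  then show thesis
    using that m by blast
qed

text \<open>A minimal element strictly above \<open>x\<close> and below \<open>y\<close> covers
  \<open>x\<close>. Minimality is taken among the labels under inclusion, which mirrors the order of
  the lattice.\<close>

lemma ex_cover_below:
  assumes "x \<in> carrier L" "y \<in> carrier L" "x \<sqsubseteq> y" "x \<noteq> y"
  obtains z where "covers L z x" "z \<sqsubseteq> y"
proof -
  define Z where "Z = {z \<in> carrier L. x \<sqsubseteq> z \<and> x \<noteq> z \<and> z \<sqsubseteq> y}"
  have "finite (label ` Z)" "label y \<in> label ` Z"
    using assms finite_carrier by (auto simp: Z_def)
  then obtain K where K: "K \<in> label ` Z" "\<forall>K' \<in> label ` Z. K' \<subseteq> K \<longrightarrow> K = K'"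
    using finite_has_minimal2[of "label ` Z" "label y"] by blast
  then obtain z where z: "z \<in> Z" "K = label z"
    by blast
  have minimal: "label w = label z" if "w \<in> Z" "label w \<subseteq> label z" for w
    using K(2) that unfolding z(2) by (metis imageI)
  have "\<not> (w \<sqsubseteq> z \<and> w \<noteq> z)" if w: "w \<in> carrier L" "x \<sqsubseteq> w" "x \<noteq> w" for w
  proof
    assume wz: "w \<sqsubseteq> z \<and> w \<noteq> z"
    then have "w \<in> Z"
      using z(1) w assms le_trans unfolding Z_def by blast
    moreover have "label w \<subseteq> label z"
      using label_subset_iff wz w z(1) unfolding Z_def by blast
    ultimately have "z \<sqsubseteq> w"
      using minimal label_subset_iff[of z w] w(1) z(1) unfolding Z_def by blast
    then show False
      using wz w z(1) le_antisym unfolding Z_def by blast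
  qed
  then have "covers L z x"
    using z(1) assms(1) unfolding covers_def lless_def eq_is_equal Z_def by blast
  then show thesis
    using that z(1) unfolding Z_def by blast
qed

lemma sym_hasse_diagram: "(x, y) \<in> parcs (hasse_diagram L) \<Longrightarrow> (y, x) \<in> parcs (hasse_diagram L)"
  by (auto simp: hasse_diagram_def)

text \<open>Climb from \<open>x\<close> by covers that stay below \<open>y\<close>: each one removes
  exactly one element from \<open>label y - label x\<close>.\<close>

lemma relpow_hasse_diagram_if_le:
  assumes "x \<in> carrier L" "y \<in> carrier L" "x \<sqsubseteq> y"
  shows "(x, y) \<in> parcs (hasse_diagram L) ^^ card (label y - label x)"
  using assms
proof (induction "card (label y - label x)" arbitrary: x)
  case 0
  then have "label y \<subseteq> label x"
    using finite_label by simp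
  then have "x = y"
    using 0 label_subset_iff le_antisym by blast
  then show ?case by simp
next
  case (Suc k)
  then have "x \<noteq> y"
    by auto
  then obtain z where z: "covers L z x" "z \<sqsubseteq> y"
    using ex_cover_below Suc.prems by blast
  then have "z \<in> carrier L"
    by (simp add: covers_def)
  obtain m where m: "m \<notin> label x" "label z = insert m (label x)"
    using label_cover z by blast
  moreover have "label z \<subseteq> label y"
    using label_subset_iff z \<open>z \<in> carrier L\<close> Suc.prems by blast
  ultimately have "label y - label x = insert m (label y - label z)" "m \<notin> label y - label z"
    by auto
  then have card: "card (label y - label x) = Suc (card (label y - label z))"
    using finite_label by simp
  then have "(z, y) \<in> parcs (hasse_diagram L) ^^ card (label y - label z)"
    using Suc z \<open>z \<in> carrier L\<close> by simp
  moreover have "(x, z) \<in> parcs (hasse_diagram L)"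
    using z by (simp add: hasse_diagram_def)
  ultimately show ?case
    unfolding card by (rule relpow_Suc_I2[rotated])
qed

text \<open>
  A geodesic from \<open>x\<close> to \<open>y\<close> climbs from \<open>x\<close> to the join of \<open>x\<close> and \<open>y\<close> and descends from there:
  every covering step changes the label in exactly one element.
\<close>
lemma relpow_hasse_diagram_card_label:
  assumes "x \<in> carrier L" "y \<in> carrier L"
  shows "(x, y) \<in> parcs (hasse_diagram L) ^^ card (sym_diff (label x) (label y))"
proof -
  let ?E = "parcs (hasse_diagram L)"
  have "(x, x \<squnion> y) \<in> ?E ^^ card (label y - label x)"
    using relpow_hasse_diagram_if_le[of x "x \<squnion> y"] assms
    by (simp add: join_left label_join Un_Diff)
  moreover have "(y, x \<squnion> y) \<in> ?E ^^ card (label x - label y)"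
    using relpow_hasse_diagram_if_le[of y "x \<squnion> y"] assms
    by (simp add: join_right label_join Un_Diff)
  then have "(x \<squnion> y, y) \<in> ?E ^^ card (label x - label y)"
    using relpow_symI sym_hasse_diagram by metis
  ultimately have "(x, y) \<in> ?E ^^ (card (label y - label x) + card (label x - label y))"
    unfolding relpow_add by blast
  moreover have "card (sym_diff (label x) (label y)) = card (label y - label x) + card (label x - label y)"
    using finite_label by (subst card_Un_disjoint) auto
  ultimately show ?thesis
    by (rule back_subst[of "\<lambda>k. (x, y) \<in> ?E ^^ k", OF _ HOL.sym])
qed

lemma card_sym_diff_label_arc:
  assumes "(x, y) \<in> parcs (hasse_diagram L)"
  shows "card (sym_diff (label x) (label y)) \<le> 1"
proof -
  have *: "card (sym_diff (label a) (label b)) \<le> 1" if b: "covers L b a" for a b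
  proof -
    obtain m where "m \<notin> label a" "label b = insert m (label a)"
      by (rule label_cover[OF b])
    then have "sym_diff (label a) (label b) \<subseteq> {m}"
      by auto
    then show ?thesis
      using card_mono[of "{m}"] by simp
  qed
  have "covers L y x \<or> covers L x y"
    using assms by (auto simp: hasse_diagram_def)
  then show ?thesis
    using *[of x y] *[of y x] by (metis Un_commute)
qed

lemma cube_labelling_hasse_diagram: "cube_labelling (hasse_diagram L) label"
proof (rule cube_labellingI[OF pair_wf_digraph_hasse_diagram finite_label card_sym_diff_label_arc])
  show "(x, y) \<in> parcs (hasse_diagram L) ^^ card (sym_diff (label x) (label y))"
    if "x \<in> pverts (hasse_diagram L)" "y \<in> pverts (hasse_diagram L)" for x y
    using relpow_hasse_diagram_card_label[of x y] that unfolding hasse_diagram_def by simp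
qed

end

text \<open>Labelling each vertex by the label of its copy in the lattice gives a cube labelling of
  \<open>G\<close>.\<close>

lemma partial_cube_if_isometric_in_uld_hasse_diagram:
  assumes "upper_locally_distributive L" "contains_isometrically (hasse_diagram L) G"
    and "pair_wf_digraph G" "finite (pverts G)"
  shows "partial_cube G"
proof -
  interpret uld_lattice L
    using assms(1) by (simp add: uld_lattice_def uld_lattice_axioms_def upper_locally_distributive_def)
  obtain g where g: "g ` pverts G \<subseteq> pverts (hasse_diagram L)"
    "\<And>u v. u \<in> pverts G \<Longrightarrow> v \<in> pverts G \<Longrightarrow>
      graph_dist (hasse_diagram L) (g u) (g v) = graph_dist G u v"
    using contains_isometricallyE[OF assms(2,3)] by blast
  have "cube_labelling G (\<lambda>u. label (g u))"
    unfolding cube_labelling_def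
  proof (intro conjI ballI finite_label)
    fix u v assume uv: "u \<in> pverts G" "v \<in> pverts G"
    then have "g u \<in> pverts (hasse_diagram L)" "g v \<in> pverts (hasse_diagram L)"
      using g(1) by auto
    then show "graph_dist G u v = ereal (real (card (sym_diff (label (g u)) (label (g v)))))"
      using cube_labelling_hasse_diagram unfolding cube_labelling_def g(2)[OF uv, symmetric] by blast
  qed
  then show ?thesis
    by (rule partial_cube_if_cube_labelling[OF assms(3,4)])
qed

section \<open>Convex sets of a partial cube\<close>

text \<open>Equality in the triangle inequality holds exactly if no coordinate is changed on the way
  to \<open>B\<close> and changed back afterwards, that is, if the two symmetric differences are
  disjoint.\<close>

lemma card_sym_diff_additive_iff:
  assumes "finite A" "finite B" "finite C"
  shows "card (sym_diff A B) + card (sym_diff B C) = card (sym_diff A C) \<longleftrightarrow>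
    A \<inter> C \<subseteq> B \<and> B \<subseteq> A \<union> C"
proof -
  let ?P = "sym_diff A B" and ?Q = "sym_diff B C"
  have fin: "finite ?P" "finite ?Q"
    using assms by auto
  have sum: "card ?P + card ?Q = card (?P \<union> ?Q) + card (?P \<inter> ?Q)"
    by (rule card_Un_Int[OF fin])
  have iff: "?P \<inter> ?Q = {} \<longleftrightarrow> A \<inter> C \<subseteq> B \<and> B \<subseteq> A \<union> C"
    by blast
  have le: "card (sym_diff A C) \<le> card (?P \<union> ?Q)"
    using fin by (intro card_mono) auto
  have "card ?P + card ?Q = card (sym_diff A C) \<longleftrightarrow> ?P \<inter> ?Q = {}"
  proof
    assume "card ?P + card ?Q = card (sym_diff A C)"
    then have "card (?P \<inter> ?Q) = 0"
      using sum le by linarith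
    then show "?P \<inter> ?Q = {}"
      using fin by (meson card_0_eq finite_Int)
  next
    assume empty: "?P \<inter> ?Q = {}"
    then have "?P \<union> ?Q = sym_diff A C"
      by blast
    then show "card ?P + card ?Q = card (sym_diff A C)"
      using sum unfolding empty by simp
  qed
  then show ?thesis
    unfolding iff .
qed

lemma card_sym_diff_eq_1E:
  assumes "card (sym_diff A B) = 1"
  obtains i where "i \<notin> A" "B = insert i A" | i where "i \<notin> B" "A = insert i B"
proof -
  obtain i where i: "sym_diff A B = {i}"
    using assms by (rule card_1_singletonE)
  then have cases: "A - B \<subseteq> {i}" "B - A \<subseteq> {i}" "i \<in> A - B \<or> i \<in> B - A"
    by (metis Un_upper1, metis Un_upper2, metis UnE insertI1)
  from cases(3) show thesis
  proof (elim disjE)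
    assume "i \<in> A - B"
    then have "A = insert i B"
      using cases by blast
    with \<open>i \<in> A - B\<close> show thesis
      using that(2) by blast
  next
    assume "i \<in> B - A"
    then have "B = insert i A"
      using cases by blast
    with \<open>i \<in> B - A\<close> show thesis
      using that(1) by blast
  qed
qed

text \<open>
  The coordinates are normalised so that the root \<open>v\<close> is labelled by the empty set. Then
  \<open>{u \<in> pverts G. i \<notin> f u}\<close> is the side of \<open>v\<close> of the coordinate \<open>i\<close>.
\<close>
locale rooted_partial_cube = connected_pair_graph +
  fixes f :: "'a \<Rightarrow> 'i set" and v :: 'a
  assumes v: "v \<in> pverts G" and f_v: "f v = {}"
    and finite_f: "u \<in> pverts G \<Longrightarrow> finite (f u)"
    and d_eq: "u \<in> pverts G \<Longrightarrow> w \<in> pverts G \<Longrightarrow> d u w = card (sym_diff (f u) (f w))"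
begin

abbreviation L :: "'a pair_pre_digraph gorder" where
  "L \<equiv> convex_poset G v"

lemma f_eq_iff:
  assumes "u \<in> pverts G" "w \<in> pverts G"
  shows "f u = f w \<longleftrightarrow> u = w"
  using d_eq_0_iff[OF assms] d_eq[OF assms] by auto

text \<open>The interval of the cube: \<open>z\<close>, the vertex in the middle, agrees with
  \<open>u\<close> and \<open>w\<close> in every coordinate in which these two agree.\<close>

definition between :: "'a \<Rightarrow> 'a \<Rightarrow> 'a \<Rightarrow> bool" where
  "between u w z \<longleftrightarrow> f u \<inter> f w \<subseteq> f z \<and> f z \<subseteq> f u \<union> f w"

lemma between_iff:
  assumes "u \<in> pverts G" "w \<in> pverts G" "z \<in> pverts G"
  shows "d u z + d z w = d u w \<longleftrightarrow> between u w z"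
  unfolding between_def using card_sym_diff_additive_iff[of "f u" "f z" "f w"] assms
  by (simp only: d_eq finite_f)

lemma between_trans:
  assumes "between x u z" "between z u y"
  shows "between x u y"
  using assms unfolding between_def by blast

lemma convex_sets_iff:
  "X \<in> convex_sets v \<longleftrightarrow> X \<subseteq> pverts G \<and> v \<in> X \<and>
     (\<forall>u \<in> X. \<forall>w \<in> X. \<forall>z \<in> pverts G. between u w z \<longrightarrow> z \<in> X)"
proof (cases "X \<subseteq> pverts G")
  case True
  then have "d u z + d z w = d u w \<longleftrightarrow> between u w z"
    if "u \<in> X" "w \<in> X" "z \<in> pverts G" for u w z
    using between_iff that by blast
  with True show ?thesis
    unfolding convex_sets_def geodesically_convex_def by (simp add: conj_commute cong: ball_cong_simp)
next
  case False
  then show ?thesis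
    by (simp add: convex_sets_def geodesically_convex_def)
qed

lemma convex_setsI:
  assumes "X \<subseteq> pverts G" "v \<in> X"
    and "\<And>u w z. u \<in> X \<Longrightarrow> w \<in> X \<Longrightarrow> z \<in> pverts G \<Longrightarrow> between u w z \<Longrightarrow> z \<in> X"
  shows "X \<in> convex_sets v"
  unfolding convex_sets_iff using assms by blast

lemma convex_setsD:
  assumes "X \<in> convex_sets v"
  shows "X \<subseteq> pverts G" "v \<in> X"
    and "u \<in> X \<Longrightarrow> w \<in> X \<Longrightarrow> z \<in> pverts G \<Longrightarrow> between u w z \<Longrightarrow> z \<in> X"
  using assms unfolding convex_sets_iff by blast+

text \<open>If \<open>X\<close> contains \<open>v\<close>, whose label is empty, these are the
  coordinates that are not constant on \<open>X\<close>.\<close>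

definition span :: "'a set \<Rightarrow> 'i set" where
  "span X = \<Union> (f ` X)"

definition below :: "'i set \<Rightarrow> 'a set" where
  "below T = {u \<in> pverts G. f u \<subseteq> T}"

text \<open>The label of a vertex between \<open>u\<close> and \<open>w\<close> is contained in
  \<open>f u \<union> f w\<close>.\<close>

lemma below_in_convex_sets: "below T \<in> convex_sets v"
  using v f_v by (intro convex_setsI) (auto simp: below_def between_def)

lemma span_mono: "X \<subseteq> Y \<Longrightarrow> span X \<subseteq> span Y"
  by (auto simp: span_def)

lemma span_below:
  assumes "u \<in> pverts G"
  shows "span (below (f u)) = f u"
  using assms by (auto simp: span_def below_def)

text \<open>The arc changes one coordinate \<open>i\<close>. If it removed \<open>i\<close>, then
  \<open>y\<close> would be between \<open>x\<close> and \<open>v\<close>. If it adds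
  \<open>i\<close> and some \<open>z\<close> in \<open>X\<close> had \<open>i\<close> in its label,
  then \<open>y\<close> would be between \<open>x\<close> and \<open>z\<close>. Convexity excludes
  both.\<close>

lemma arc_leaving_convex_set:
  assumes X: "X \<in> convex_sets v" and arc: "(x, y) \<in> parcs G" "x \<in> X" "y \<notin> X"
  obtains i where "i \<notin> span X" "f y = insert i (f x)"
proof -
  have xy: "x \<in> pverts G" "y \<in> pverts G"
    using arc wellformed' by auto
  have "card (sym_diff (f x) (f y)) = 1"
    using d_eq[OF xy] d_arc[OF arc(1)] by simp
  then show thesis
  proof (cases rule: card_sym_diff_eq_1E)
    case (1 i)
    have "i \<notin> f z" if "z \<in> X" for z
    proof
      assume "i \<in> f z"
      then have "between x z y"
        using 1 by (auto simp: between_def)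
      then show False
        using convex_setsD(3)[OF X] arc xy that by blast
    qed
    then show thesis
      using that[of i] 1 by (auto simp: span_def)
  next
    case (2 i)
    then have "between x v y"
      using f_v by (auto simp: between_def)
    then show thesis
      using convex_setsD(2,3)[OF X] arc xy by blast
  qed
qed

text \<open>Follow a geodesic from \<open>x\<close> to \<open>u\<close> up to the first arc that
  leaves \<open>X\<close>. Its new coordinate \<open>i\<close> lies in \<open>f x\<close> or in
  \<open>f u\<close> by betweenness, and the span of \<open>X\<close> excludes the former.\<close>

lemma boundary_arc:
  assumes X: "X \<in> convex_sets v" and "x \<in> X" "u \<in> pverts G" "u \<notin> X"
  obtains x' y i where "x' \<in> X" "y \<in> pverts G - X" "i \<notin> span X" "f y = insert i (f x')"
    "between x u y" "i \<in> f u"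
proof -
  have "\<exists>x' \<in> X. \<exists>y. (x', y) \<in> parcs G \<and> y \<notin> X \<and> between x u y"
    using assms(2)
  proof (induction "d x u" arbitrary: x rule: less_induct)
    case less
    have x: "x \<in> pverts G" "x \<noteq> u"
      using less.prems assms convex_setsD(1)[OF X] by auto
    then obtain z where z: "(x, z) \<in> parcs G" "d x u = Suc (d z u)"
      using ex_arc_on_geodesic assms(3) by blast
    then have "z \<in> pverts G"
      using in_arcsD2 by blast
    then have btw: "between x u z"
      using between_iff[of x u z] x assms(3) z d_arc[OF z(1)] by simp
    show ?case
    proof (cases "z \<in> X")
      case True
      then show ?thesis
        using less.hyps[of z] z(2) between_trans[OF btw] by auto
    qed (use btw z less.prems in blast)
  qed
  then obtain x' y where y: "x' \<in> X" "(x', y) \<in> parcs G" "y \<notin> X" "between x u y"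
    by blast
  obtain i where i: "i \<notin> span X" "f y = insert i (f x')"
    using arc_leaving_convex_set[OF X y(2,1,3)] by blast
  have "i \<in> f u"
    using y i assms(2) by (auto simp: between_def span_def)
  moreover have "y \<in> pverts G - X"
    using y in_arcsD2 by blast
  ultimately show thesis
    using that y i by blast
qed

text \<open>Convex sets are determined by their spans: a vertex outside \<open>X\<close> has in its
  label the new coordinate of a boundary arc, which is not in the span.\<close>

lemma below_span:
  assumes X: "X \<in> convex_sets v"
  shows "below (span X) = X"
proof
  show "below (span X) \<subseteq> X"
  proof
    fix u assume u: "u \<in> below (span X)"
    show "u \<in> X"
    proof (rule ccontr)
      assume "u \<notin> X"
      then obtain i where "i \<notin> span X" "i \<in> f u"
        using boundary_arc[OF X convex_setsD(2)[OF X]] u unfolding below_def by blast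
      then show False
        using u unfolding below_def by blast
    qed
  qed
  show "X \<subseteq> below (span X)"
    using convex_setsD(1)[OF X] unfolding below_def span_def by blast
qed

section \<open>Half-spaces as the meet-irreducible convex sets\<close>

definition halfspace :: "'i \<Rightarrow> 'a set" where
  "halfspace i = below (- {i})"

lemma halfspace_eq: "halfspace i = {u \<in> pverts G. i \<notin> f u}"
  by (auto simp: halfspace_def below_def)

text \<open>For convex \<open>X\<close>, the coordinates changed by arcs leaving \<open>X\<close>,
  since labels that differ in one element belong to adjacent vertices.\<close>

definition bounding :: "'a set \<Rightarrow> 'i set" where
  "bounding X = {i. i \<notin> span X \<and> (\<exists>x \<in> X. \<exists>y \<in> pverts G. f y = insert i (f x))}"

text \<open>Let the arc from \<open>x\<close> to \<open>y\<close> cross the cut \<open>i\<close>. A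
  convex set properly containing the half-space has a member \<open>w\<close> beyond the cut, and
  \<open>y\<close> is between \<open>x\<close> and \<open>w\<close>. Thus any meet of such sets
  contains \<open>y\<close>, which the half-space does not.\<close>

lemma meet_irreducible_halfspace:
  assumes X: "X \<in> convex_sets v" and i: "i \<in> bounding X"
  shows "meet_irreducible L (induced (halfspace i))"
  unfolding meet_irreducible_def
proof (intro conjI allI impI)
  have H: "halfspace i \<in> convex_sets v"
    using below_in_convex_sets by (simp add: halfspace_def)
  then show "induced (halfspace i) \<in> carrier L"
    by (simp add: carrier_convex_poset)
  obtain x y where xy: "x \<in> X" "y \<in> pverts G" "f y = insert i (f x)"
    using i by (auto simp: bounding_def)
  have "i \<notin> f x"
    using i xy by (auto simp: bounding_def span_def)
  then have x: "x \<in> halfspace i"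
    using xy convex_setsD(1)[OF X] by (auto simp: halfspace_eq)
  fix A assume A: "A \<subseteq> carrier L" "is_glb L (induced (halfspace i)) A"
  then obtain \<C> where C: "\<C> \<subseteq> convex_sets v" "A = induced ` \<C>"
    unfolding carrier_convex_poset subset_image_iff by blast
  then have eq: "halfspace i = pverts G \<inter> \<Inter> \<C>"
    using A(2) is_glb_convex_poset_iff[OF v C(1)] by simp
  show "induced (halfspace i) \<in> A"
  proof (rule ccontr)
    assume notin: "induced (halfspace i) \<notin> A"
    have "y \<in> Z" if Z: "Z \<in> \<C>" for Z
    proof -
      have "halfspace i \<subseteq> Z" "halfspace i \<noteq> Z"
        using eq Z notin C by auto
      then obtain w where w: "w \<in> Z" "w \<notin> halfspace i"
        by blast
      have cz: "Z \<in> convex_sets v"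
        using C Z by blast
      then have "w \<in> pverts G"
        using convex_setsD(1) w by blast
      then have "i \<in> f w"
        using w by (simp add: halfspace_eq)
      then have "between x w y"
        using xy by (auto simp: between_def)
      then show ?thesis
        using convex_setsD(3)[OF cz] x w \<open>halfspace i \<subseteq> Z\<close> xy(2) by blast
    qed
    then have "y \<in> halfspace i"
      using eq xy by blast
    then show False
      using xy by (simp add: halfspace_eq)
  qed
qed

text \<open>A vertex outside \<open>X\<close> is cut off by the coordinate of a boundary arc on the
  way to it.\<close>

lemma mi_representation_bounding:
  assumes X: "X \<in> convex_sets v"
  shows "mi_representation L (induced X) (induced ` halfspace ` bounding X)"
proof -
  have "X = pverts G \<inter> \<Inter> (halfspace ` bounding X)"
  proof
    show "X \<subseteq> pverts G \<inter> \<Inter> (halfspace ` bounding X)"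
      using convex_setsD(1)[OF X] by (auto simp: halfspace_eq bounding_def span_def)
    show "pverts G \<inter> \<Inter> (halfspace ` bounding X) \<subseteq> X"
    proof
      fix u assume u: "u \<in> pverts G \<inter> \<Inter> (halfspace ` bounding X)"
      show "u \<in> X"
      proof (rule ccontr)
        assume notin: "u \<notin> X"
        have "u \<in> pverts G"
          using u by blast
        then obtain x y i where "x \<in> X" "y \<in> pverts G - X" "i \<notin> span X" "f y = insert i (f x)" "i \<in> f u"
          using boundary_arc[OF X convex_setsD(2)[OF X] _ notin] by metis
        then have "i \<in> bounding X" "u \<notin> halfspace i"
          by (auto simp: bounding_def halfspace_eq)
        then show False
          using u by blast
      qed
    qed
  qed
  moreover have "halfspace ` bounding X \<subseteq> convex_sets v"
    using below_in_convex_sets by (auto simp: halfspace_def)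
  ultimately have "is_glb L (induced X) (induced ` halfspace ` bounding X)"
    using is_glb_convex_poset_iff[OF v] by simp
  then show ?thesis
    using meet_irreducible_halfspace[OF X] by (auto simp: mi_representation_def)
qed

text \<open>A meet-irreducible element occurs in each of its representations, in particular in the
  one by bounding half-spaces.\<close>

lemma meet_irreducibleE:
  assumes "meet_irreducible L m"
  obtains i where "m = induced (halfspace i)"
proof -
  obtain X where X: "X \<in> convex_sets v" "m = induced X"
    using assms by (auto simp: meet_irreducible_def carrier_convex_poset)
  have "is_glb L m (induced ` halfspace ` bounding X)"
    using mi_representation_bounding[OF X(1)] X(2) by (simp add: mi_representation_def)
  moreover have "induced ` halfspace ` bounding X \<subseteq> carrier L"
    using below_in_convex_sets by (auto simp: halfspace_def carrier_convex_poset)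
  ultimately have "m \<in> induced ` halfspace ` bounding X"
    using assms by (auto simp: meet_irreducible_def)
  then show thesis
    using that by blast
qed

text \<open>For an arc from \<open>x\<close> in \<open>X\<close> to \<open>y\<close> that adds
  \<open>i\<close>, some member of \<open>M\<close> must contain \<open>x\<close> but not
  \<open>y\<close>. The members are half-spaces, and only that of \<open>i\<close> separates the
  two.\<close>

lemma bounding_subset_mi_representation:
  assumes X: "X \<in> convex_sets v" and M: "mi_representation L (induced X) M"
  shows "induced ` halfspace ` bounding X \<subseteq> M"
proof -
  have mi: "\<exists>j. m = induced (halfspace j)" if "m \<in> M" for m
    using M that meet_irreducibleE unfolding mi_representation_def by blast
  define \<C> where "\<C> = {X. X \<in> range halfspace \<and> induced X \<in> M}"
  have M_eq: "M = induced ` \<C>"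
    using mi unfolding \<C>_def by blast
  have C: "\<C> \<subseteq> convex_sets v"
    using below_in_convex_sets by (auto simp: \<C>_def halfspace_def)
  have X_eq: "X = pverts G \<inter> \<Inter> \<C>"
    using M is_glb_convex_poset_iff[OF v C] unfolding M_eq mi_representation_def by simp
  have "halfspace i \<in> \<C>" if i: "i \<in> bounding X" for i
  proof -
    obtain x y where xy: "x \<in> X" "y \<in> pverts G" "f y = insert i (f x)"
      using i by (auto simp: bounding_def)
    then have "y \<notin> X"
      using i by (auto simp: bounding_def span_def)
    then obtain j where j: "halfspace j \<in> \<C>" "y \<notin> halfspace j"
      using X_eq xy unfolding \<C>_def by blast
    moreover have "x \<in> halfspace j"
      using j X_eq xy by blast
    ultimately have "j = i"
      using xy by (auto simp: halfspace_eq)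
    then show ?thesis
      using j by simp
  qed
  then show ?thesis
    unfolding M_eq by blast
qed

text \<open>A representation contained in all others is the only minimal one.\<close>

lemma upper_locally_distributive_convex_poset: "upper_locally_distributive L"
  unfolding upper_locally_distributive_def
proof (intro conjI ballI lattice_convex_poset[OF v] finite_carrier_convex_poset)
  fix x assume "x \<in> carrier L"
  then obtain X where X: "X \<in> convex_sets v" "x = induced X"
    by (auto simp: carrier_convex_poset)
  note rep = mi_representation_bounding[OF X(1), folded X(2)]
    and sub = bounding_subset_mi_representation[OF X(1), folded X(2)]
  show "\<exists>!M. mi_representation L x M \<and> (\<forall>M' \<subset> M. \<not> mi_representation L x M')"
  proof (intro ex1I conjI allI impI notI)
    show "mi_representation L x (induced ` halfspace ` bounding X)"
      by (rule rep)
    show False if "M' \<subset> induced ` halfspace ` bounding X" "mi_representation L x M'" for M'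
      using that sub[of M'] by blast
    show "M = induced ` halfspace ` bounding X"
      if "mi_representation L x M \<and> (\<forall>M' \<subset> M. \<not> mi_representation L x M')" for M
      using that sub[of M] rep by blast
  qed
qed

section \<open>Spans along covers, and the isometric copy of \<open>G\<close> in the Hasse
  diagram\<close>

lemma span_cover:
  assumes X: "X \<in> convex_sets v" and Y: "Y \<in> convex_sets v"
    and cover: "covers L (induced Y) (induced X)"
  obtains i where "span Y = insert i (span X)"
proof -
  have sub: "X \<subset> Y" and between_sets: "\<not> (\<exists>Z \<in> convex_sets v. X \<subset> Z \<and> Z \<subset> Y)"
    using cover unfolding covers_convex_poset_iff[OF X Y] by simp_all
  obtain u where u: "u \<in> Y" "u \<notin> X"
    using sub by blast
  then have "u \<in> pverts G"
    using convex_setsD(1)[OF Y] by blast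
  \<comment> \<open>The end \<open>y\<close> of the boundary arc is between \<open>v\<close> and
    \<open>u\<close>, both in \<open>Y\<close>, so convexity puts it into \<open>Y\<close>.\<close>
  with u obtain x y i where y: "x \<in> X" "y \<in> pverts G - X" "i \<notin> span X" "f y = insert i (f x)" "between v u y"
    using boundary_arc[OF X convex_setsD(2)[OF X]] by metis
  then have "y \<in> Y"
    using convex_setsD(2,3)[OF Y] u by blast
  \<comment> \<open>\<open>Z\<close> is convex, lies in \<open>Y\<close> and properly contains
    \<open>X\<close> because of \<open>y\<close>; the cover forces it to be \<open>Y\<close>, so the
    span of \<open>Y\<close> gains only \<open>i\<close>.\<close>
  define Z where "Z = Y \<inter> below (insert i (span X))"
  have "Z \<in> convex_sets v"
    using convex_setsD[OF Y] convex_setsD[OF below_in_convex_sets[of "insert i (span X)"]]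
    unfolding Z_def by (intro convex_setsI) blast+
  moreover have "X \<subseteq> Z" "y \<in> Z"
    using y sub \<open>y \<in> Y\<close> convex_setsD(1)[OF X] by (auto simp: Z_def below_def span_def)
  moreover have "Z \<subseteq> Y"
    by (simp add: Z_def)
  ultimately have "Z = Y"
    using between_sets y(2) by blast
  then have "span Y \<subseteq> insert i (span X)"
    unfolding Z_def span_def below_def by blast
  moreover have "insert i (span X) \<subseteq> span Y"
    using sub \<open>y \<in> Y\<close> y(4) by (auto simp: span_def)
  ultimately show thesis
    using that by blast
qed

text \<open>The convex hull of \<open>v\<close> and \<open>u\<close>: as \<open>f v\<close> is
  empty, the vertices between the two are those with label inside \<open>f u\<close>.\<close>

definition root_hull :: "'a \<Rightarrow> 'a pair_pre_digraph" where
  "root_hull u = induced (below (f u))"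

text \<open>The span of a convex set in between would lie between \<open>f x\<close> and
  \<open>f y\<close>, which differ in one element. It equals one of them, and
  \<open>below_span\<close> recovers the set.\<close>

lemma covers_root_hull:
  assumes "x \<in> pverts G" "y \<in> pverts G" "i \<notin> f x" "f y = insert i (f x)"
  shows "covers L (root_hull y) (root_hull x)"
  unfolding root_hull_def covers_convex_poset_iff[OF below_in_convex_sets below_in_convex_sets]
proof (intro conjI notI)
  show "below (f x) \<subset> below (f y)"
    using assms by (auto simp: below_def)
  assume "\<exists>Z \<in> convex_sets v. below (f x) \<subset> Z \<and> Z \<subset> below (f y)"
  then obtain Z where Z: "Z \<in> convex_sets v" "below (f x) \<subset> Z" "Z \<subset> below (f y)"
    by blast
  then have "f x \<subseteq> span Z" "span Z \<subseteq> f y"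
    using span_mono[of "below (f x)" Z] span_mono[of Z "below (f y)"]
      span_below[OF assms(1)] span_below[OF assms(2)] by blast+
  then have "span Z = f x \<or> span Z = f y"
    unfolding assms(4) by (cases "i \<in> span Z") blast+
  then have "Z = below (f x) \<or> Z = below (f y)"
    using below_span[OF Z(1)] by metis
  then show False
    using Z by blast
qed

lemma root_hull_arc:
  assumes "(x, y) \<in> parcs G"
  shows "(root_hull x, root_hull y) \<in> parcs (hasse_diagram L)"
proof -
  have xy: "x \<in> pverts G" "y \<in> pverts G"
    using assms wellformed' by auto
  then have "card (sym_diff (f x) (f y)) = 1"
    using d_eq d_arc[OF assms] by simp
  then have "covers L (root_hull y) (root_hull x) \<or> covers L (root_hull x) (root_hull y)"
    using covers_root_hull xy by (elim card_sym_diff_eq_1E) blast+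
  then show ?thesis
    by (auto simp: hasse_diagram_def)
qed

lemma finite_span: "X \<in> convex_sets v \<Longrightarrow> finite (span X)"
  using convex_setsD(1)[of X] pair_finite_verts finite_f unfolding span_def
  by (intro finite_UN_I) (auto intro: finite_subset)

text \<open>The carrier claims give this the shape of the first premise of
  \<open>card_sym_diff_le_relpow\<close>.\<close>

lemma card_sym_diff_span_arc:
  assumes "(A, B) \<in> parcs (hasse_diagram L)"
  shows "A \<in> carrier L \<and> B \<in> carrier L \<and> card (sym_diff (span (pverts A)) (span (pverts B))) \<le> 1"
proof -
  have cover: "card (sym_diff (span X) (span Y)) \<le> 1"
    if XY: "X \<in> convex_sets v" "Y \<in> convex_sets v" "covers L (induced Y) (induced X)" for X Y
  proof -
    obtain i where "span Y = insert i (span X)"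
      by (rule span_cover[OF XY])
    then have "sym_diff (span X) (span Y) \<subseteq> {i}"
      by auto
    then show ?thesis
      using card_mono[of "{i}"] by simp
  qed
  have AB: "A \<in> carrier L" "B \<in> carrier L" "covers L B A \<or> covers L A B"
    using assms by (auto simp: hasse_diagram_def covers_def)
  then obtain X Y where XY: "X \<in> convex_sets v" "A = induced X" "Y \<in> convex_sets v" "B = induced Y"
    by (auto simp: carrier_convex_poset)
  then have "card (sym_diff (span X) (span Y)) \<le> 1"
    using cover[of X Y] cover[of Y X] AB(3) by (metis Un_commute)
  then show ?thesis
    using AB XY by simp
qed

text \<open>Arcs of \<open>G\<close> become edges of the Hasse diagram, which bounds its distance
  from above. Spans change by at most one element per edge and the span of
  \<open>root_hull u\<close> is \<open>f u\<close>, which bounds it from below.\<close>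

lemma graph_dist_root_hull:
  assumes "x \<in> pverts G" "y \<in> pverts G"
  shows "graph_dist (hasse_diagram L) (root_hull x) (root_hull y) = graph_dist G x y"
  unfolding graph_dist_eq_d[OF assms]
proof (rule graph_dist_eqI[OF pair_wf_digraph_hasse_diagram])
  have carrier: "root_hull x \<in> carrier L"
    unfolding root_hull_def carrier_convex_poset using below_in_convex_sets by blast
  then show "root_hull x \<in> pverts (hasse_diagram L)"
    by (simp add: hasse_diagram_def)
  show "(root_hull x, root_hull y) \<in> parcs (hasse_diagram L) ^^ d x y"
    using relpow_d[OF assms] root_hull_arc by (rule relpow_map_prod)
  fix k assume k: "(root_hull x, root_hull y) \<in> parcs (hasse_diagram L) ^^ k"
  have "card (sym_diff (span (pverts (root_hull x))) (span (pverts (root_hull y)))) \<le> k"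
    by (rule card_sym_diff_le_relpow[where f = "\<lambda>A. span (pverts A)", OF card_sym_diff_span_arc _ carrier k])
      (auto simp: carrier_convex_poset finite_span)
  then show "d x y \<le> k"
    using assms by (simp add: root_hull_def span_below d_eq)
qed

lemma contains_isometrically_hasse_diagram: "contains_isometrically (hasse_diagram L) G"
proof (rule contains_isometricallyI[OF pair_graph pair_wf_digraph_hasse_diagram])
  show "inj_on root_hull (pverts G)"
  proof (rule inj_onI)
    fix x y assume xy: "x \<in> pverts G" "y \<in> pverts G" "root_hull x = root_hull y"
    then have "f x = f y"
      using span_below unfolding root_hull_def induced_eq_iff by metis
    then show "x = y"
      using f_eq_iff xy by blast
  qed
  show "root_hull ` pverts G \<subseteq> pverts (hasse_diagram L)"
    using below_in_convex_sets by (auto simp: root_hull_def hasse_diagram_def carrier_convex_poset)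
qed (rule root_hull_arc graph_dist_root_hull; assumption)+

end

theorem theorem7:
  fixes G :: "'a pair_pre_digraph"
  assumes "pair_graph G" and "Digraph_Component.connected (with_proj G)"
  shows "partial_cube G \<longleftrightarrow>
    (\<forall>v \<in> pverts G. upper_locally_distributive (convex_poset G v) \<and>
       contains_isometrically (hasse_diagram (convex_poset G v)) G)"
proof
  interpret connected_pair_graph G
    using assms by (simp add: connected_pair_graph_def connected_pair_graph_axioms_def)
  assume "partial_cube G"
  then obtain f :: "'a \<Rightarrow> nat set" where f: "cube_labelling G f"
    by (rule cube_labelling_if_partial_cube)
  show "\<forall>v \<in> pverts G. upper_locally_distributive (convex_poset G v) \<and>
      contains_isometrically (hasse_diagram (convex_poset G v)) G"
  proof
    fix v assume v: "v \<in> pverts G"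
    \<comment> \<open>The symmetric difference with \<open>f v\<close> translates the cube: it
      preserves Hamming distances and sends the label of \<open>v\<close> to the empty set.\<close>
    interpret rooted_partial_cube G "\<lambda>u. sym_diff (f u) (f v)" v
    proof unfold_locales
      fix u assume "u \<in> pverts G"
      then show "finite (sym_diff (f u) (f v))"
        using f v by (simp add: cube_labelling_def)
    next
      fix u w assume uw: "u \<in> pverts G" "w \<in> pverts G"
      then have "d u w = card (sym_diff (f u) (f w))"
        using f graph_dist_eq_d unfolding cube_labelling_def by simp
      moreover have "sym_diff (sym_diff (f u) (f v)) (sym_diff (f w) (f v)) = sym_diff (f u) (f w)"
        by blast
      ultimately show "d u w = card (sym_diff (sym_diff (f u) (f v)) (sym_diff (f w) (f v)))"
        by (simp only:)
    qed (use v in auto)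
    show "upper_locally_distributive (convex_poset G v) \<and>
        contains_isometrically (hasse_diagram (convex_poset G v)) G"
      using upper_locally_distributive_convex_poset contains_isometrically_hasse_diagram by blast
  qed
next
  interpret connected_pair_graph G
    using assms by (simp add: connected_pair_graph_def connected_pair_graph_axioms_def)
  assume *: "\<forall>v \<in> pverts G. upper_locally_distributive (convex_poset G v) \<and>
      contains_isometrically (hasse_diagram (convex_poset G v)) G"
  \<comment> \<open>Connectedness includes the existence of a vertex, at which the assumption is
    then applied.\<close>
  have "pverts G \<noteq> {}"
    using symmetric_connected_imp_strongly_connected sym_arcs connected
    by (auto simp: strongly_connected_def)
  then obtain v where "v \<in> pverts G"
    by blast
  with * show "partial_cube G"
    using partial_cube_if_isometric_in_uld_hasse_diagram pair_wf_digraph pair_finite_verts by blast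
qed

end
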